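(* The ApproxMaxCRS algorithm returns a $(1/4)$-approximate answer to the MaxCRS problem: if $\hat p$ is the point returned by ApproxMaxCRS on an instance $(O,w,d)$, then $$\sum_{o\in O_{c(\hat p)}}w(o)\;\ge\;\frac14\,\max_{p\in\mathbb{R}^2}\ \sum_{o\in O_{c(p)}}w(o).$$
   Context: MaxCRS problem. Given a finite set $O$ of points (objects) in $\mathbb{R}^2$ with weights $w(o)\ge0$ and a diameter $d>0$, find a location $p\in\mathbb{R}^2$ maximizing $\sum_{o\in O_{c(p)}}w(o)$, where $c(p)$ is the circular region of diameter $d$ centered at $p$ and $O_{c(p)}$ is the set of objects covered by $c(p)$. Objects on the boundary of a region are not covered, so $c(p)$ is effectively an open disk. Algorithm ApproxMaxCRS. Let $C$ be the set of open disks of diameter $d$ centered at the objects $o\in O$, the disk at $o$ having weight $w(o)$. Let $R$ be the set of their minimum bounding rectangles, i.e. the open axis-parallel $d\times d$ squares centered at the objects, with the same weights. The location-weight of a point with respect to $R$ is the sum of the weights of the members of $R$ covering it. A max-region with regard to $R$ is a rectangle $\rho$ all of whose points have the same location-weight $\tau$ with respect to $R$, such that no point of the plane has location-weight higher than $\tau$. The algorithm: (1) computes a max-region $\rho$ with regard to $R$ (using the exact algorithm ExactMaxRS); (2) lets $p_0$ be the center of $\rho$; (3) forms four shifted points $p_1,\dots,p_4$ at distance $\sigma$ from $p_0$ in the four diagonal directions, i.e. the points $p_0+(\pm\sigma/\sqrt2,\pm\sigma/\sqrt2)$, where the shifting distance $\sigma$ is any fixed value with $(\sqrt2-1)\frac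 d2<\sigma<\frac d2$; (4) returns a point $\hat p$ among $p_0,\dots,p_4$ that maximizes the total weight of the disks in $C$ covering it. *)

theory Defs
  imports "HOL-Analysis.Analysis"
begin

text \<open>The weight covered by the open disk of diameter \<open>d\<close> placed at \<open>p\<close>: the objective of MaxCRS.\<close>

definition covered_weight :: "(real^2) set \<Rightarrow> (real^2 \<Rightarrow> real) \<Rightarrow> real \<Rightarrow> real^2 \<Rightarrow> real" where
  "covered_weight Obj w d p = (\<Sum>o'\<in>{o'\<in>Obj. o' \<in> ball p (d/2)}. w o')"

definition disk_at :: "real \<Rightarrow> real^2 \<Rightarrow> (real^2) set" where
  "disk_at d c = ball c (d/2)"

definition square_at :: "real \<Rightarrow> real^2 \<Rightarrow> (real^2) set" where
  "square_at d c = box (c - vector [d/2, d/2]) (c + vector [d/2, d/2])"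

text \<open>A set of weighted regions, one per object, is given as a function \<open>reg\<close> from objects to
  regions; the region of an object inherits the weight of that object.\<close>

definition location_weight ::
    "(real^2) set \<Rightarrow> (real^2 \<Rightarrow> real) \<Rightarrow> (real^2 \<Rightarrow> (real^2) set) \<Rightarrow> real^2 \<Rightarrow> real" where
  "location_weight Obj w reg p = (\<Sum>o'\<in>{o'\<in>Obj. p \<in> reg o'}. w o')"

text \<open>Bounded, nondegenerate axis-parallel rectangles with lower left corner \<open>a\<close> and upper right
  corner \<open>b\<close>. Each of the four sides may be open or closed: \<^const>\<open>is_interval\<close> on the plane
  characterizes the products of two intervals.\<close>

definition is_rectangle :: "real^2 \<Rightarrow> real^2 \<Rightarrow> (real^2) set \<Rightarrow> bool" where
  "is_rectangle a b \<rho> \<longleftrightarrow> a $ 1 < b $ 1 \<and> a $ 2 < b $ 2 \<and> is_interval \<rho> \<and> closure \<rho> = cbox a b"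

definition max_region ::
    "(real^2) set \<Rightarrow> (real^2 \<Rightarrow> real) \<Rightarrow> (real^2 \<Rightarrow> (real^2) set) \<Rightarrow> (real^2) set \<Rightarrow> bool" where
  "max_region Obj w reg \<rho> \<longleftrightarrow>
     (\<exists>\<tau>. (\<forall>p\<in>\<rho>. location_weight Obj w reg p = \<tau>) \<and> (\<forall>q. location_weight Obj w reg q \<le> \<tau>))"

definition candidates :: "real \<Rightarrow> real^2 \<Rightarrow> (real^2) set" where
  "candidates \<sigma> p\<^sub>0 =
     (let s = \<sigma> / sqrt 2
      in {p\<^sub>0, p\<^sub>0 + vector [s, s], p\<^sub>0 + vector [s, - s],
          p\<^sub>0 + vector [- s, s], p\<^sub>0 + vector [- s, - s]})"

text \<open>The input-output relation of ApproxMaxCRS with shifting distance \<open>\<sigma>\<close>. It is a relation,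
  since neither the max-region nor the best candidate need be unique: the
  exact subroutine may deliver any max-region, and ties between candidates may be broken
  arbitrarily.\<close>

definition approx_maxcrs ::
    "(real^2) set \<Rightarrow> (real^2 \<Rightarrow> real) \<Rightarrow> real \<Rightarrow> real \<Rightarrow> real^2 \<Rightarrow> bool" where
  "approx_maxcrs Obj w d \<sigma> p \<longleftrightarrow>
     (\<exists>a b \<rho>. is_rectangle a b \<rho> \<and> max_region Obj w (square_at d) \<rho> \<and>
        is_arg_max (location_weight Obj w (disk_at d)) (\<lambda>q. q \<in> candidates \<sigma> (midpoint a b)) p)"

text \<open>Only finitely many weights can be covered, so the maximum over the plane is attained.\<close>

lemma finite_range_covered_weight:
  assumes "finite Obj"
  shows "finite (range (covered_weight Obj w d))"
proof (rule finite_subset)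
  show "range (covered_weight Obj w d) \<subseteq> sum w ` Pow Obj"
    unfolding covered_weight_def by auto
qed (use assms in simp)

lemma finite_range_location_weight:
  assumes "finite Obj"
  shows "finite (range (location_weight Obj w reg))"
proof (rule finite_subset)
  show "range (location_weight Obj w reg) \<subseteq> sum w ` Pow Obj"
    unfolding location_weight_def by auto
qed (use assms in simp)

text \<open>Every instance has an output.\<close>

lemma approx_maxcrs_exists:
  assumes fin: "finite Obj" and nn: "\<And>x. x \<in> Obj \<Longrightarrow> 0 \<le> w x"
  shows "\<exists>p. approx_maxcrs Obj w d \<sigma> p"
proof -
  let ?L = "location_weight Obj w (square_at d)"
  have "Max (range ?L) \<in> range ?L"
    using finite_range_location_weight[OF fin] by (intro Max_in) auto
  then obtain q where "?L q = Max (range ?L)" by (metis imageE)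
  then have q: "?L x \<le> ?L q" for x
    using finite_range_location_weight[OF fin] by simp
  define S where "S = (\<Inter>x\<in>{x\<in>Obj. q \<in> square_at d x}. square_at d x)"
  have "open S" unfolding S_def using fin by (intro open_INT) (auto simp: square_at_def)
  moreover have "q \<in> S" by (auto simp: S_def)
  ultimately obtain a b where ab: "q \<in> box a b" "box a b \<subseteq> S"
    by (rule open_contains_box) blast
  have "?L x = ?L q" if "x \<in> box a b" for x
  proof (rule antisym)
    show "?L q \<le> ?L x"
      unfolding location_weight_def
      by (rule sum_mono2) (use fin nn ab(2) that in \<open>auto simp: S_def\<close>)
  qed (rule q)
  then have "max_region Obj w (square_at d) (box a b)"
    unfolding max_region_def using q by blast
  moreover have "is_rectangle a b (box a b)"
  proof -
    have "a $ i < b $ i" for i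
      using ab(1) by (auto simp: mem_box_cart intro: less_trans)
    moreover have "closure (box a b) = cbox a b"
      using ab(1) by (intro closure_box) auto
    ultimately show ?thesis
      by (simp add: is_rectangle_def is_interval_box)
  qed
  moreover obtain p where "is_arg_max (location_weight Obj w (disk_at d))
      (\<lambda>x. x \<in> candidates \<sigma> (midpoint a b)) p"
  proof -
    let ?C = "candidates \<sigma> (midpoint a b)"
    let ?D = "location_weight Obj w (disk_at d)"
    have C: "finite ?C" "?C \<noteq> {}"
      by (auto simp: candidates_def Let_def)
    then have "Max (?D ` ?C) \<in> ?D ` ?C"
      by (intro Max_in) auto
    then obtain p where "p \<in> ?C" "?D p = Max (?D ` ?C)" by (metis imageE)
    then have "is_arg_max ?D (\<lambda>x. x \<in> ?C) p"
      using C(1) by (simp add: is_arg_max_linorder)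
    then show ?thesis by (rule that)
  qed
  ultimately show ?thesis unfolding approx_maxcrs_def by blast
qed

end

theory Submission
  imports Defs
begin

text \<open>A disk is contained in its bounding square, so the MaxCRS optimum is at most the maximum
  location-weight \<open>\<tau>\<close> of the squares. The center \<open>p\<^sub>0\<close> of the max-region lies in that region, so
  \<open>\<tau>\<close> is the weight of the objects in the open \<open>d \<times> d\<close> square around \<open>p\<^sub>0\<close>. The range of \<open>\<sigma>\<close> is
  such that the four open disks around the shifted points cover this square, so one of them
  covers weight at least \<open>\<tau> / 4\<close>.\<close>

text \<open>Distance is symmetric, so the disk placed at \<open>p\<close> covers an object exactly
  when the disk around that object covers \<open>p\<close>. This turns the choice of a disk into the
  choice of a point.\<close>

lemma covered_weight_eq_location_weight:
  "covered_weight Obj w d p = location_weight Obj w (disk_at d) p"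
  by (simp add: covered_weight_def location_weight_def disk_at_def dist_commute)

lemma mem_square_at_iff: "p \<in> square_at d c \<longleftrightarrow> (\<forall>i. \<bar>p $ i - c $ i\<bar> < d / 2)"
  by (auto simp del: less_divide_eq_numeral1 simp: square_at_def mem_box_cart forall_2 abs_less_iff)

lemma mem_disk_at_iff:
  assumes "0 \<le> d"
  shows "p \<in> disk_at d c \<longleftrightarrow> (p $ 1 - c $ 1)\<^sup>2 + (p $ 2 - c $ 2)\<^sup>2 < (d / 2)\<^sup>2"
proof -
  have "p \<in> disk_at d c \<longleftrightarrow> norm (p - c) < d / 2"
    by (simp add: disk_at_def dist_norm norm_minus_commute)
  also have "\<dots> \<longleftrightarrow> (norm (p - c))\<^sup>2 < (d / 2)\<^sup>2"
    using assms power2_less_imp_less[of "norm (p - c)" "d / 2"]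
    by (auto intro: power_strict_mono)
  also have "(norm (p - c))\<^sup>2 = (p $ 1 - c $ 1)\<^sup>2 + (p $ 2 - c $ 2)\<^sup>2"
    unfolding power2_norm_eq_inner by (simp add: inner_vec_def sum_2 power2_eq_square)
  finally show ?thesis .
qed

lemma disk_at_subset_square_at: "disk_at d c \<subseteq> square_at d c"
proof
  fix p assume "p \<in> disk_at d c"
  then have "norm (p - c) < d / 2"
    by (simp add: disk_at_def dist_norm norm_minus_commute)
  moreover have "\<bar>(p - c) $ i\<bar> \<le> norm (p - c)" for i
    by (rule component_le_norm_cart)
  ultimately show "p \<in> square_at d c"
    unfolding mem_square_at_iff by (metis le_less_trans vector_minus_component)
qed

text \<open>A convex set has the same interior as its closure, so \<open>\<rho>\<close> contains the
  whole open box, whichever of its sides are closed.\<close>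

lemma midpoint_in_rectangle:
  assumes "is_rectangle a b \<rho>"
  shows "midpoint a b \<in> \<rho>"
proof -
  have ab: "a $ 1 < b $ 1" "a $ 2 < b $ 2" and "convex \<rho>" and cl: "closure \<rho> = cbox a b"
    using assms by (auto simp: is_rectangle_def is_interval_convex)
  from \<open>convex \<rho>\<close> have "box a b = interior \<rho>"
    using convex_interior_closure[of \<rho>] by (simp add: cl interior_cbox)
  moreover have "midpoint a b \<in> box a b"
    using ab by (simp add: mem_box_cart forall_2 midpoint_def field_simps)
  ultimately show ?thesis
    using interior_subset by blast
qed

text \<open>By reflection it suffices to shift towards the quadrant that contains \<open>x\<close>; the two
  bounds on \<open>s\<close> say that both \<open>s\<close> and \<open>r - s\<close> are below \<open>r / sqrt 2\<close>.\<close>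

lemma shifted_coordinate_bound:
  fixes x r s :: real
  assumes x: "\<bar>x\<bar> < r" and s: "s < r / sqrt 2" "r - s < r / sqrt 2"
  shows "\<exists>t\<in>{s, - s}. (x - t)\<^sup>2 < r\<^sup>2 / 2"
proof -
  define t where "t = (if 0 \<le> x then s else - s)"
  have "\<bar>x - t\<bar> < r / sqrt 2"
    using assms by (auto simp: t_def abs_if split: if_splits)
  then have "\<bar>x - t\<bar>\<^sup>2 < (r / sqrt 2)\<^sup>2"
    by (intro power_strict_mono) auto
  then have "(x - t)\<^sup>2 < r\<^sup>2 / 2"
    by (simp add: power_divide)
  then show ?thesis by (auto simp: t_def split: if_splits)
qed

text \<open>The signs of the two shifts are chosen independently, one per coordinate. Each squared
  offset then drops below \<open>r\<^sup>2 / 2\<close>, and their sum stays below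
  \<open>r\<^sup>2\<close>.\<close>

lemma square_covered_by_shifted_disks:
  assumes "0 < d" and \<sigma>: "(sqrt 2 - 1) * (d / 2) < \<sigma>" "\<sigma> < d / 2"
    and p: "p \<in> square_at d c"
  shows "\<exists>t\<in>{\<sigma> / sqrt 2, - (\<sigma> / sqrt 2)}. \<exists>u\<in>{\<sigma> / sqrt 2, - (\<sigma> / sqrt 2)}.
           p + vector [t, u] \<in> disk_at d c"
proof -
  define r s where "r = d / 2" and "s = \<sigma> / sqrt 2"
  have "s < r / sqrt 2"
    unfolding r_def s_def using \<sigma>(2) by (intro divide_strict_right_mono) auto
  moreover have "r - s < r / sqrt 2"
  proof -
    have "r - r / sqrt 2 = (sqrt 2 - 1) * r / sqrt 2"
      by (simp add: field_simps)
    also have "\<dots> < s"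
      unfolding s_def r_def using \<sigma>(1) by (intro divide_strict_right_mono) auto
    finally show ?thesis
      by simp
  qed
  ultimately have *: "\<exists>t\<in>{s, - s}. (x - t)\<^sup>2 < r\<^sup>2 / 2" if "\<bar>x\<bar> < r" for x
    using shifted_coordinate_bound that by blast
  \<comment> \<open>The offset is taken from \<open>p\<close> to \<open>c\<close>, so that
    \<open>t\<close> and \<open>u\<close> shift \<open>p\<close> into the quadrant that contains
    \<open>c\<close>.\<close>
  have "\<bar>c $ i - p $ i\<bar> < r" for i
    using p by (simp add: mem_square_at_iff r_def abs_minus_commute)
  with * obtain t u where t: "t \<in> {s, - s}" "(c $ 1 - p $ 1 - t)\<^sup>2 < r\<^sup>2 / 2"
    and u: "u \<in> {s, - s}" "(c $ 2 - p $ 2 - u)\<^sup>2 < r\<^sup>2 / 2"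
    by meson
  have "(p $ 1 + t - c $ 1)\<^sup>2 + (p $ 2 + u - c $ 2)\<^sup>2
      = (c $ 1 - p $ 1 - t)\<^sup>2 + (c $ 2 - p $ 2 - u)\<^sup>2"
    by (simp add: power2_eq_square algebra_simps)
  also have "\<dots> < r\<^sup>2"
    using t(2) u(2) by linarith
  finally have "p + vector [t, u] \<in> disk_at d c"
    using \<open>0 < d\<close> by (simp add: mem_disk_at_iff r_def)
  with t(1) u(1) show ?thesis
    unfolding s_def by blast
qed

lemma location_weight_mono:
  assumes "finite Obj" and "\<And>x. x \<in> Obj \<Longrightarrow> 0 \<le> w x" and "\<And>x. reg x \<subseteq> reg' x"
  shows "location_weight Obj w reg p \<le> location_weight Obj w reg' p"
  unfolding location_weight_def
  by (rule sum_mono2) (use assms in auto)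

text \<open>A union bound: every object counted on the left is counted at least once on the right,
  and since weights are nonnegative, repeated counts only enlarge the sum.\<close>

lemma location_weight_le_sum:
  assumes "finite Obj" and "\<And>x. x \<in> Obj \<Longrightarrow> 0 \<le> w x" and "finite Q"
    and cover: "\<And>x. p \<in> reg x \<Longrightarrow> \<exists>q\<in>Q. q \<in> reg' x"
  shows "location_weight Obj w reg p \<le> (\<Sum>q\<in>Q. location_weight Obj w reg' q)"
proof -
  \<comment> \<open>With indicators the index set no longer depends on the point, so the sums over
    objects and over \<open>Q\<close> can be exchanged.\<close>
  have eq: "location_weight Obj w r q = (\<Sum>x\<in>Obj. if q \<in> r x then w x else 0)" for r q
    using \<open>finite Obj\<close> by (simp add: location_weight_def sum.inter_filter)
  have "(if p \<in> reg x then w x else 0) \<le> (\<Sum>q\<in>Q. if q \<in> reg' x then w x else 0)"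
    if "x \<in> Obj" for x
  proof (cases "p \<in> reg x")
    case True
    then obtain q where "q \<in> Q" "q \<in> reg' x" using cover by blast
    moreover have "(if q \<in> reg' x then w x else 0) \<le> (\<Sum>q\<in>Q. if q \<in> reg' x then w x else 0)"
      using \<open>q \<in> Q\<close> assms(2)[OF that] \<open>finite Q\<close> by (intro member_le_sum) auto
    ultimately show ?thesis using True by simp
  next
    case False
    then show ?thesis using assms(2)[OF that] by (simp add: sum_nonneg)
  qed
  then have "location_weight Obj w reg p \<le> (\<Sum>x\<in>Obj. \<Sum>q\<in>Q. if q \<in> reg' x then w x else 0)"
    unfolding eq by (rule sum_mono)
  also have "\<dots> = (\<Sum>q\<in>Q. location_weight Obj w reg' q)"
    unfolding eq by (rule sum.swap)
  finally show ?thesis .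
qed

theorem theorem3:
  fixes Obj :: "(real^2) set" and w :: "real^2 \<Rightarrow> real" and d \<sigma> :: real and phat :: "real^2"
  assumes "finite Obj"
    and "\<And>x. x \<in> Obj \<Longrightarrow> 0 \<le> w x"
    and "0 < d"
    and "(sqrt 2 - 1) * (d / 2) < \<sigma>" and "\<sigma> < d / 2"
    and "approx_maxcrs Obj w d \<sigma> phat"
  shows "covered_weight Obj w d phat \<ge> 1 / 4 * Max (range (covered_weight Obj w d))"
proof -
  let ?D = "location_weight Obj w (disk_at d)" and ?S = "location_weight Obj w (square_at d)"
  obtain a b \<rho> where \<rho>: "is_rectangle a b \<rho>" "max_region Obj w (square_at d) \<rho>"
    and phat: "is_arg_max ?D (\<lambda>q. q \<in> candidates \<sigma> (midpoint a b)) phat"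
    using assms(6) unfolding approx_maxcrs_def by blast
  define p0 where "p0 = midpoint a b"
  define T where "T = {\<sigma> / sqrt 2, - (\<sigma> / sqrt 2)}"
  \<comment> \<open>These are the four shifted candidates; \<open>p0\<close> itself is left out,
    which gives the factor 4 rather than 5.\<close>
  define Q where "Q = (\<lambda>(t, u). p0 + vector [t, u] :: real^2) ` (T \<times> T)"
  have S_le: "?S q \<le> ?S p0" for q
    using \<rho>(2) midpoint_in_rectangle[OF \<rho>(1)] by (auto simp: max_region_def p0_def)
  have "finite Q"
    by (simp add: Q_def T_def)
  have "card T \<le> 2"
    by (simp add: T_def card_insert_if)
  have "card Q \<le> card (T \<times> T)"
    unfolding Q_def by (rule card_image_le) (simp add: T_def)
  also have "\<dots> \<le> 2 * 2"
    using \<open>card T \<le> 2\<close> by (simp only: card_cartesian_product mult_le_mono)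
  finally have "card Q \<le> 4"
    by simp
  have Q_le: "?D q \<le> ?D phat" if "q \<in> Q" for q
  proof -
    have "q \<in> candidates \<sigma> p0"
      using that by (auto simp: Q_def T_def candidates_def Let_def)
    then show ?thesis
      using phat by (simp add: p0_def is_arg_max_linorder)
  qed
  \<comment> \<open>This sign allows \<open>card Q\<close> to be replaced by its upper bound 4 in
    the final estimate.\<close>
  have "0 \<le> ?D phat"
    unfolding location_weight_def using assms(2) by (intro sum_nonneg) auto
  have "\<exists>q\<in>Q. q \<in> disk_at d x" if "p0 \<in> square_at d x" for x
    using square_covered_by_shifted_disks[OF assms(3-5) that]
    unfolding Q_def T_def[symmetric] by force
  then have "?S p0 \<le> (\<Sum>q\<in>Q. ?D q)"
    using assms(1,2) \<open>finite Q\<close> by (intro location_weight_le_sum)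
  also have "\<dots> \<le> card Q * ?D phat"
    using Q_le by (rule sum_bounded_above)
  also have "\<dots> \<le> 4 * ?D phat"
    using \<open>card Q \<le> 4\<close> \<open>0 \<le> ?D phat\<close> by (intro mult_right_mono) auto
  finally have S_p0: "?S p0 \<le> 4 * ?D phat" .
  have "covered_weight Obj w d q \<le> 4 * ?D phat" for q
  proof -
    have "?D q \<le> ?S q"
      by (intro location_weight_mono assms disk_at_subset_square_at)
    then show ?thesis
      using S_le[of q] S_p0 by (simp add: covered_weight_eq_location_weight)
  qed
  then have "Max (range (covered_weight Obj w d)) \<le> 4 * ?D phat"
    using finite_range_covered_weight[OF assms(1)] by simp
  then show ?thesis
    by (simp add: covered_weight_eq_location_weight)
qed

end
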